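(* Let $A\in\mathbb{R}^{n\times n}$, $B\in\mathbb{R}^{n\times m_1}$, $C\in\mathbb{R}^{p_1\times n}$, $D\in\mathbb{R}^{p_1\times m_1}$, $E\in\mathbb{R}^{n\times p_2}$ be the matrices of a quantum plant with nonsingular CCR matrix $\Theta_1\in\mathbb{A}_n$, satisfying $$A\Theta_1+\Theta_1A^{\mathrm T}+BJ_1B^{\mathrm T}+E\widetilde J_2E^{\mathrm T}=0,\qquad C\Theta_1+DJ_1B^{\mathrm T}=0.$$ Let the controller feedthrough matrix $d\in\mathbb{R}^{p_2\times m_2}$ and the weighting matrices $F\in\mathbb{R}^{r\times n}$, $G\in\mathbb{R}^{r\times p_2}$ (with $G$ of full column rank) be fixed. Consider a stabilising coherent quantum controller with Luenberger dynamics and CCR matrix $\Theta_2=-\Theta_1$, given by gain matrices $b\in\mathbb{R}^{n\times m_2}$, $e\in\mathbb{R}^{n\times p_1}$ satisfying $$(B-eD)J_1(B-eD)^{\mathrm T}+(Ed-b)J_2(Ed-b)^{\mathrm T}=0$$ and such that $A-eC$ and $A+Ec$ are Hurwitz, where $c:=dJ_2b^{\mathrm T}\Theta_1^{-1}$. Let $\lambda\in\mathbb{A}_n$. Then the controller, together with the Lagrange multiplier $\lambda$, is a stationary point of the Lagrange function $$\mathcal L(b,e,\lambda):=V(b,e)+\tfrac12\big\langle\lambda,\ (B-eD)J_1(B-eD)^{\mathrm T}+(Ed-b)J_2(Ed-b)^{\mathrm T}\big\rangle$$ if and only if $$(\mathsf Q_{21}-\mathsf Q_{11})Ed+\lambda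 EdJ_2+\Theta_1^{-1}\big(\mathsf H_{22}^{\mathrm T}E+(\mathsf P_{21}+\mathsf P_{22})F^{\mathrm T}G\big)dJ_2+\mathfrak B(b)=0$$ and $$(\mathsf Q_{21}-\mathsf Q_{11})BD^{\mathrm T}+\lambda BJ_1D^{\mathrm T}+(\mathsf H_{21}-\mathsf H_{11})C^{\mathrm T}+\mathfrak E(e)=0,$$ where $\mathfrak B$, $\mathfrak E$ are the linear operators on $\mathbb{R}^{n\times m_2}$, $\mathbb{R}^{n\times p_1}$ acting as $$\mathfrak B(\vartheta):=q\vartheta+\Theta_1^{-1}\mathsf P_{22}\Theta_1^{-1}\,\vartheta\, J_2d^{\mathrm T}G^{\mathrm T}GdJ_2-\lambda\vartheta J_2,\qquad \mathfrak E(\vartheta):=q\vartheta-\lambda\vartheta\widetilde J_1,$$ with $q:=\mathsf Q_{11}+\mathsf Q_{22}-\mathsf Q_{12}-\mathsf Q_{21}$.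
   Context: Notation: $\mathbb{A}_r$ is the space of real antisymmetric matrices of order $r$; $I_r$ is the identity matrix; $\otimes$ is the Kronecker product; $\langle\cdot,\cdot\rangle$ is the Frobenius inner product of real matrices. The dimensions $n,m_1,m_2,p_1,p_2$ are even positive integers with $p_1\le m_1$, $p_2\le m_2$. Put $$\mathbf J:=\begin{bmatrix}0&1\\ -1&0\end{bmatrix},\qquad J_k:=I_{m_k/2}\otimes\mathbf J\quad(k=1,2).$$ The feedthrough matrix $D$ (respectively $d$) is formed from conjugate pairs of rows of a permutation matrix of order $m_1$ (respectively $m_2$), so that $DD^{\mathrm T}=I_{p_1}$, $dd^{\mathrm T}=I_{p_2}$, and $$\widetilde J_1:=DJ_1D^{\mathrm T}=I_{p_1/2}\otimes\mathbf J,\qquad \widetilde J_2:=dJ_2d^{\mathrm T}=I_{p_2/2}\otimes\mathbf J.$$ Controller: the controller is $\mathrm d\xi=a\xi\,\mathrm dt+b\,\mathrm d\omega+e\,\mathrm dy$, $\mathrm d\eta=c\xi\,\mathrm dt+d\,\mathrm d\omega$ with $a=A-eC+Ec$ (Luenberger structure). With $\Theta_2=-\Theta_1$, its physical realizability conditions $a\Theta_2+\Theta_2a^{\mathrm T}+bJ_2b^{\mathrm T}+e\widetilde J_1e^{\mathrm T}=0$, $c\Theta_2+dJ_2b^{\mathrm T}=0$ amount to $c=dJ_2b^{\mathrm T}\Theta_1^{-1}$ and the quadratic constraint on $(b,e)$ in the claim. Thus the controller is determined by $(b,e)$. Closed-loop matrices: for $b\in\mathbb{R}^{n\times m_2}$,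 $e\in\mathbb{R}^{n\times p_1}$ and $c=dJ_2b^{\mathrm T}\Theta_1^{-1}$, let $$\mathsf A:=\begin{bmatrix}A-eC&0\\ eC&A+Ec\end{bmatrix},\quad \mathsf B:=\begin{bmatrix}B-eD&Ed-b\\ eD&b\end{bmatrix},\quad \mathsf C:=\begin{bmatrix}F&F+Gc\end{bmatrix}.$$ The controller is stabilising if $\mathsf A$ is Hurwitz (all eigenvalues have negative real part), i.e. $A-eC$ and $A+Ec$ are Hurwitz. In this case $\mathsf P,\mathsf Q\in\mathbb{R}^{2n\times2n}$ denote the unique solutions of $$\mathsf A\mathsf P+\mathsf P\mathsf A^{\mathrm T}+\mathsf B\mathsf B^{\mathrm T}=0,\qquad \mathsf A^{\mathrm T}\mathsf Q+\mathsf Q\mathsf A+\mathsf C^{\mathrm T}\mathsf C=0,$$ and $\mathsf H:=\mathsf Q\mathsf P$. All three are partitioned into $n\times n$ blocks $(\cdot)_{jk}$, $j,k=1,2$. Cost: on the open set of $(b,e)$ for which $\mathsf A$ is Hurwitz, the mean square (LQG) cost is $V(b,e)=\frac12\langle\mathsf C^{\mathrm T}\mathsf C,\mathsf P\rangle$. The CQLQG problem in this class is the minimisation of $V$ over such $(b,e)$ subject to the quadratic constraint. Stationarity: a stationary point of $\mathcal L$ is a point $(b,e,\lambda)$, with $\mathsf A$ Hurwitz, at which the Frechet derivatives of $\mathcal L$ with respect to the independent variables $b\in\mathbb{R}^{n\times m_2}$, $e\in\mathbb{R}^{n\times p_1}$ and $\lambda\in\mathbb{A}_n$ all vanish. The derivative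 in $\lambda$ vanishes precisely when the quadratic constraint holds. *)

theory Defs
  imports "HOL-Analysis.Analysis"
begin

(* An even positive order m is represented by the index type 'm \<times> 2 with CARD('m) = m/2:
   the pair (k, s) is row 2(k-1)+s, in accordance with the Kronecker structure of
   I_{m/2} \<otimes> J.  The Frobenius inner product of real matrices is the library's inner
   product on real^'n^'m. *)

definition kron :: "real^'b^'a \<Rightarrow> real^'d^'c \<Rightarrow> real^('b \<times> 'd)^('a \<times> 'c)" where
  "kron M N = (\<chi> i j. M $ fst i $ fst j * N $ snd i $ snd j)"

definition symp :: "real^('k::finite \<times> 2)^('k \<times> 2)" where
  "symp = kron (mat 1) (vector [vector [0, 1], vector [-1, 0]])"

definition antisym_mats :: "(real^'n^'n) set" where
  "antisym_mats = {M. transpose M = - M}"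

definition perm_matrix :: "real^'k^'k \<Rightarrow> bool" where
  "perm_matrix M \<longleftrightarrow> (\<exists>\<sigma>. bij \<sigma> \<and> M = (\<chi> i j. if j = \<sigma> i then 1 else 0))"

(* The conjugate pair of rows number i of the feedthrough matrix is the pair number f i of
   the permutation matrix. *)
definition feedthrough :: "real^('m::finite \<times> 2)^('p::finite \<times> 2) \<Rightarrow> bool" where
  "feedthrough D \<longleftrightarrow>
     (\<exists>M f. perm_matrix M \<and> inj f \<and> (\<forall>i s. D $ (i, s) = M $ (f i, s))) \<and>
     D ** transpose D = mat 1 \<and> D ** symp ** transpose D = symp"

definition hurwitz :: "real^'n^'n \<Rightarrow> bool" where
  "hurwitz M \<longleftrightarrow>
     (\<forall>(z::complex) v. v \<noteq> 0 \<and> map_matrix complex_of_real M *v v = z *s v \<longrightarrow> Re z < 0)"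

(* Meaningful only if the solution is unique, in particular for Hurwitz M. *)
definition lyap :: "real^'n^'n \<Rightarrow> real^'n^'n \<Rightarrow> real^'n^'n" where
  "lyap M N = (THE X. M ** X + X ** transpose M + N = 0)"

definition hcat :: "real^'a^'r \<Rightarrow> real^'b^'r \<Rightarrow> real^('a + 'b)^'r" where
  "hcat M N = (\<chi> i j. case j of Inl k \<Rightarrow> M $ i $ k | Inr k \<Rightarrow> N $ i $ k)"

definition vcat :: "real^'c^'a \<Rightarrow> real^'c^'b \<Rightarrow> real^'c^('a + 'b)" where
  "vcat M N = (\<chi> i. case i of Inl k \<Rightarrow> M $ k | Inr k \<Rightarrow> N $ k)"

definition blk11 :: "real^('a::finite + 'b::finite)^('c::finite + 'd::finite) \<Rightarrow> real^'a^'c" where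
  "blk11 M = (\<chi> i j. M $ Inl i $ Inl j)"

definition blk12 :: "real^('a::finite + 'b::finite)^('c::finite + 'd::finite) \<Rightarrow> real^'b^'c" where
  "blk12 M = (\<chi> i j. M $ Inl i $ Inr j)"

definition blk21 :: "real^('a::finite + 'b::finite)^('c::finite + 'd::finite) \<Rightarrow> real^'a^'d" where
  "blk21 M = (\<chi> i j. M $ Inr i $ Inl j)"

definition blk22 :: "real^('a::finite + 'b::finite)^('c::finite + 'd::finite) \<Rightarrow> real^'b^'d" where
  "blk22 M = (\<chi> i j. M $ Inr i $ Inr j)"

definition ctrl_c ::
  "real^('m2::finite \<times> 2)^('p2::finite \<times> 2) \<Rightarrow> real^'n^'n \<Rightarrow> real^('m2 \<times> 2)^'n \<Rightarrow> real^'n^('p2 \<times> 2)"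
where
  "ctrl_c d \<Theta> b = d ** symp ** transpose b ** matrix_inv \<Theta>"

definition cl_A ::
  "real^'n^'n \<Rightarrow> real^'n^'p1 \<Rightarrow> real^'p2^'n \<Rightarrow> real^'n^'p2 \<Rightarrow> real^'p1^'n \<Rightarrow> real^('n + 'n)^('n + 'n)"
where
  "cl_A A C E c e = vcat (hcat (A - e ** C) 0) (hcat (e ** C) (A + E ** c))"

definition cl_B ::
  "real^'m1^'n \<Rightarrow> real^'m1^'p1 \<Rightarrow> real^'p2^'n \<Rightarrow> real^'m2^'p2 \<Rightarrow> real^'m2^'n \<Rightarrow> real^'p1^'n
    \<Rightarrow> real^('m1 + 'm2)^('n + 'n)"
where
  "cl_B B D E d b e = vcat (hcat (B - e ** D) (E ** d - b)) (hcat (e ** D) b)"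

definition cl_C :: "real^'n^'r \<Rightarrow> real^'p2^'r \<Rightarrow> real^'n^'p2 \<Rightarrow> real^('n + 'n)^'r" where
  "cl_C F G c = hcat F (F + G ** c)"

definition ctrl_gram :: "real^'n^'n \<Rightarrow> real^'m^'n \<Rightarrow> real^'n^'n" where
  "ctrl_gram M N = lyap M (N ** transpose N)"

definition obs_gram :: "real^'n^'n \<Rightarrow> real^'n^'r \<Rightarrow> real^'n^'n" where
  "obs_gram M N = lyap (transpose M) (transpose N ** N)"

definition lqg_cost ::
  "real^'n^'n \<Rightarrow> real^('m1::finite \<times> 2)^'n \<Rightarrow> real^'n^('p1::finite \<times> 2)
    \<Rightarrow> real^('m1 \<times> 2)^('p1 \<times> 2) \<Rightarrow> real^('p2::finite \<times> 2)^'n \<Rightarrow> real^'n^'r \<Rightarrow> real^('p2 \<times> 2)^'r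
    \<Rightarrow> real^('m2::finite \<times> 2)^('p2 \<times> 2) \<Rightarrow> real^'n^'n
    \<Rightarrow> real^('m2 \<times> 2)^'n \<Rightarrow> real^('p1 \<times> 2)^'n \<Rightarrow> real"
where
  "lqg_cost A B C D E F G d \<Theta> b e =
    (let c = ctrl_c d \<Theta> b; CC = cl_C F G c
     in (1/2) * inner (transpose CC ** CC) (ctrl_gram (cl_A A C E c e) (cl_B B D E d b e)))"

definition pr_constraint ::
  "real^('m1::finite \<times> 2)^'n \<Rightarrow> real^('m1 \<times> 2)^('p1::finite \<times> 2) \<Rightarrow> real^('p2::finite \<times> 2)^'n
    \<Rightarrow> real^('m2::finite \<times> 2)^('p2 \<times> 2) \<Rightarrow> real^('m2 \<times> 2)^'n \<Rightarrow> real^('p1 \<times> 2)^'n \<Rightarrow> real^'n^'n"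
where
  "pr_constraint B D E d b e =
     (B - e ** D) ** symp ** transpose (B - e ** D) +
     (E ** d - b) ** symp ** transpose (E ** d - b)"

definition lagrangian ::
  "real^'n^'n \<Rightarrow> real^('m1::finite \<times> 2)^'n \<Rightarrow> real^'n^('p1::finite \<times> 2)
    \<Rightarrow> real^('m1 \<times> 2)^('p1 \<times> 2) \<Rightarrow> real^('p2::finite \<times> 2)^'n \<Rightarrow> real^'n^'r \<Rightarrow> real^('p2 \<times> 2)^'r
    \<Rightarrow> real^('m2::finite \<times> 2)^('p2 \<times> 2) \<Rightarrow> real^'n^'n
    \<Rightarrow> real^('m2 \<times> 2)^'n \<Rightarrow> real^('p1 \<times> 2)^'n \<Rightarrow> real^'n^'n \<Rightarrow> real"
where
  "lagrangian A B C D E F G d \<Theta> b e \<Lambda> =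
     lqg_cost A B C D E F G d \<Theta> b e + (1/2) * inner \<Lambda> (pr_constraint B D E d b e)"

(* The multiplier ranges over the subspace of antisymmetric matrices only, so the derivative
   with respect to it is taken within that subspace. *)
definition stationary_point ::
  "real^'n^'n \<Rightarrow> real^('m1::finite \<times> 2)^'n \<Rightarrow> real^'n^('p1::finite \<times> 2)
    \<Rightarrow> real^('m1 \<times> 2)^('p1 \<times> 2) \<Rightarrow> real^('p2::finite \<times> 2)^'n \<Rightarrow> real^'n^'r \<Rightarrow> real^('p2 \<times> 2)^'r
    \<Rightarrow> real^('m2::finite \<times> 2)^('p2 \<times> 2) \<Rightarrow> real^'n^'n
    \<Rightarrow> real^('m2 \<times> 2)^'n \<Rightarrow> real^('p1 \<times> 2)^'n \<Rightarrow> real^'n^'n \<Rightarrow> bool"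
where
  "stationary_point A B C D E F G d \<Theta> b e \<Lambda> \<longleftrightarrow>
     \<Lambda> \<in> antisym_mats \<and>
     hurwitz (cl_A A C E (ctrl_c d \<Theta> b) e) \<and>
     ((\<lambda>x. lagrangian A B C D E F G d \<Theta> x e \<Lambda>) has_derivative (\<lambda>_. 0)) (at b) \<and>
     ((\<lambda>y. lagrangian A B C D E F G d \<Theta> b y \<Lambda>) has_derivative (\<lambda>_. 0)) (at e) \<and>
     ((\<lambda>l. lagrangian A B C D E F G d \<Theta> b e l) has_derivative (\<lambda>_. 0)) (at \<Lambda> within antisym_mats)"

definition op_B ::
  "real^'n^'n \<Rightarrow> real^'n^'n \<Rightarrow> real^'n^'n \<Rightarrow> real^('m2::finite \<times> 2)^('p2::finite \<times> 2)
    \<Rightarrow> real^('p2 \<times> 2)^'r \<Rightarrow> real^'n^'n \<Rightarrow> real^('m2 \<times> 2)^'n \<Rightarrow> real^('m2 \<times> 2)^'n"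
where
  "op_B q \<Theta> P22 d G \<Lambda> \<theta> =
     q ** \<theta> +
     matrix_inv \<Theta> ** P22 ** matrix_inv \<Theta> ** \<theta> ** symp ** transpose d ** transpose G ** G ** d ** symp -
     \<Lambda> ** \<theta> ** symp"

definition op_E ::
  "real^'n^'n \<Rightarrow> real^'n^'n \<Rightarrow> real^('p1::finite \<times> 2)^'n \<Rightarrow> real^('p1 \<times> 2)^'n" where
  "op_E q \<Lambda> \<theta> = q ** \<theta> - \<Lambda> ** \<theta> ** symp"

end

theory Submission
  imports Defs "HOL-Computational_Algebra.Fundamental_Theorem_Algebra"
begin

text \<open>For a Hurwitz matrix \<open>M\<close> the Lyapunov operator \<open>X \<mapsto> M X + X M\<^sup>T\<close> is injective, hence bounded below,
  and this survives small perturbations of \<open>M\<close>; so near the given controller the Gramian \<open>P\<close> is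
  well defined and continuous. Pairing with the observability Gramian \<open>Q\<close> at the base point \<open>x\<close>
  rewrites the cost as \<open>\<langle>\<Phi>(y), P(y)\<rangle> + \<langle>Q, B(y) B(y)\<^sup>T\<rangle>\<close> with \<open>\<Phi>(x) = 0\<close>, so continuity of
  \<open>P\<close> alone yields \<open>dV = \<langle>dC, C P\<rangle> + \<langle>dB, Q B\<rangle> + \<langle>dA, Q P\<rangle>\<close>. Reading off the blocks gives the
  gradients of the Lagrangian in \<open>b\<close> and \<open>e\<close>; in \<open>\<lambda>\<close> it is constant on the constraint set.\<close>

section \<open>Injectivity of the Lyapunov operator of a Hurwitz matrix\<close>

text \<open>Split a root \<mu> off \<open>p\<close>, say p = (X - \<mu>) r. Then z = T y - \<mu> y
  either vanishes, so that \<open>y\<close> is an eigenvector, or is a nonzero vector of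
  \<open>K\<close> annihilated by \<open>r\<close>, which has smaller degree. The scaling
  \<open>s\<close> is abstract so that the lemma applies to complex matrices.\<close>

lemma poly_eigenvector:
  fixes s :: "complex \<Rightarrow> 'v::ab_group_add \<Rightarrow> 'v"
  assumes T: "Vector_Spaces.linear s s T"
    and K: "module.subspace s K" "\<And>z. z \<in> K \<Longrightarrow> T z \<in> K"
    and p: "p \<noteq> 0" "(\<Sum>i\<le>degree p. s (coeff p i) ((T ^^ i) y)) = 0"
    and y: "y \<in> K" "y \<noteq> 0"
  shows "\<exists>\<mu> z. z \<in> K \<and> z \<noteq> 0 \<and> T z = s \<mu> z"
  using p y
proof (induction "degree p" arbitrary: p y)
  interpret T: Vector_Spaces.linear s s T by (rule T)
  case 0
  then obtain a where "p = [:a:]" "a \<noteq> 0" by (metis degree_eq_zeroE pCons_0_0)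
  with 0 show ?case by (simp add: T.vs1.scale_eq_0_iff)
next
  interpret T: Vector_Spaces.linear s s T by (rule T)
  case (Suc n)
  have "\<not> constant (poly p)"
    using Suc.hyps(2) by (simp add: constant_degree)
  then obtain \<mu> where "poly p \<mu> = 0"
    using fundamental_theorem_of_algebra by blast
  then obtain r where r: "p = [:-\<mu>, 1:] * r"
    by (metis dvd_def poly_eq_0_iff_dvd)
  have r0: "r \<noteq> 0" using r Suc.prems by auto
  have dp: "degree p = Suc (degree r)"
    using r0 unfolding r by (subst degree_mult_eq) auto
  define z where "z = T y - s \<mu> y"
  have zK: "z \<in> K"
    unfolding z_def using Suc.prems K by (auto intro: T.vs1.subspace_diff T.vs1.subspace_scale)
  show ?case
  proof (cases "z = 0")
    case True
    then show ?thesis using Suc.prems by (intro exI[of _ \<mu>] exI[of _ y]) (auto simp: z_def)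
  next
    case False
    \<comment> \<open>Since \<open>T\<close> commutes with T - \<mu>, this and the coefficients
      \<open>cp\<close> of (X - \<mu>) r give r(T) z = p(T) y.\<close>
    have it: "(T ^^ i) z = (T ^^ Suc i) y - s \<mu> ((T ^^ i) y)" for i
      by (induction i) (auto simp: z_def T.diff T.scale)
    have cp: "coeff p i = (if i = 0 then 0 else coeff r (i - 1)) - \<mu> * coeff r i" for i
      by (cases i) (auto simp: r coeff_pCons)
    have "(\<Sum>i\<le>degree r. s (coeff r i) ((T ^^ i) z)) =
       (\<Sum>i\<le>degree r. s (coeff r i) ((T ^^ Suc i) y)) - (\<Sum>i\<le>degree r. s (\<mu> * coeff r i) ((T ^^ i) y))"
      by (simp only: it T.vs1.scale_right_diff_distrib sum_subtractf T.vs1.scale_scale mult.commute)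
    also have "(\<Sum>i\<le>degree r. s (\<mu> * coeff r i) ((T ^^ i) y)) =
      (\<Sum>i\<le>degree p. s (\<mu> * coeff r i) ((T ^^ i) y))"
      by (rule sum.mono_neutral_left) (auto simp: dp coeff_eq_0 not_le)
    also have "(\<Sum>i\<le>degree r. s (coeff r i) ((T ^^ Suc i) y)) =
      (\<Sum>i\<le>degree p. s (if i = 0 then 0 else coeff r (i - 1)) ((T ^^ i) y))"
      unfolding dp sum.atMost_Suc_shift by simp
    finally have "(\<Sum>i\<le>degree r. s (coeff r i) ((T ^^ i) z)) = (\<Sum>i\<le>degree p. s (coeff p i) ((T ^^ i) y))"
      by (simp only: cp T.vs1.scale_left_diff_distrib sum_subtractf)
    with Suc.prems have "(\<Sum>i\<le>degree r. s (coeff r i) ((T ^^ i) z)) = 0" by simp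
    from Suc.hyps(1)[OF _ r0 this zK False] show ?thesis
      using dp Suc.hyps(2) by simp
  qed
qed

text \<open>One more vector of the orbit than the dimension must be linearly dependent; the
  coefficients of the relation are those of \<open>p\<close>.\<close>

lemma linear_orbit_dependent:
  fixes T :: "'v::euclidean_space \<Rightarrow> 'v"
  shows "\<exists>(p::real poly). p \<noteq> 0 \<and> (\<Sum>i\<le>degree p. coeff p i *\<^sub>R (T ^^ i) y) = 0"
proof -
  let ?f = "\<lambda>i. (T ^^ i) y"
  define N where "N = DIM('v)"
  have "\<exists>c. (\<exists>i\<le>N. c i \<noteq> 0) \<and> (\<Sum>i\<le>N. c i *\<^sub>R ?f i) = 0"
  \<comment> \<open>Linear dependence is a notion for sets, so an orbit with a repetition is treated
    apart: there the relation is the difference of the two equal members.\<close>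
  proof (cases "inj_on ?f {..N}")
    case True
    have "card (?f ` {..N}) = Suc N" using True by (simp add: card_image)
    then have "dependent (?f ` {..N})"
      by (intro dependent_biggerset) (auto simp: N_def)
    then obtain u where u: "\<exists>v\<in>?f ` {..N}. u v \<noteq> 0" "(\<Sum>v\<in>?f ` {..N}. u v *\<^sub>R v) = 0"
      by (subst (asm) dependent_finite) auto
    then have "(\<Sum>i\<le>N. u (?f i) *\<^sub>R ?f i) = 0"
      using True by (simp add: sum.reindex)
    then show ?thesis using u(1) by (intro exI[of _ "\<lambda>i. u (?f i)"]) auto
  next
    case False
    then obtain i j where ij: "i \<le> N" "j \<le> N" "i \<noteq> j" "?f i = ?f j"
      by (auto simp: inj_on_def)
    have "(\<Sum>k\<le>N. ((if k = i then 1 else 0) - (if k = j then 1 else 0)) *\<^sub>R ?f k) = ?f i - ?f j"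
      using ij by (simp add: scaleR_left_diff_distrib sum_subtractf if_distrib[of "\<lambda>c. c *\<^sub>R _"] cong: if_cong)
    then show ?thesis using ij
      by (intro exI[of _ "\<lambda>k. (if k = i then 1 else 0) - (if k = j then 1 else 0)"]) auto
  qed
  then obtain c i where c: "i \<le> N" "c i \<noteq> 0" "(\<Sum>i\<le>N. c i *\<^sub>R ?f i) = 0" by blast
  define p where "p = (\<Sum>i\<le>N. monom (c i) i)"
  have cp: "coeff p k = (if k \<le> N then c k else 0)" for k
    by (simp add: p_def coeff_sum if_distrib cong: if_cong)
  have "p \<noteq> 0" using c cp by (metis coeff_0)
  moreover have "degree p \<le> N" by (rule degree_le) (simp add: cp)
  then have "(\<Sum>k\<le>degree p. coeff p k *\<^sub>R ?f k) = (\<Sum>k\<le>N. coeff p k *\<^sub>R ?f k)"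
    by (intro sum.mono_neutral_left) (auto simp: coeff_eq_0 not_le)
  then have "(\<Sum>k\<le>degree p. coeff p k *\<^sub>R ?f k) = 0" using c(3) by (simp add: cp)
  ultimately show ?thesis by blast
qed

section \<open>Complex matrices as a vector space, and their eigenvectors\<close>

abbreviation cmat :: "real^'n^'m \<Rightarrow> complex^'n^'m" where
  "cmat \<equiv> map_matrix complex_of_real"

text \<open>Eigenvalues need complex scalars, whereas \<open>*\<^sub>R\<close> takes real ones and
  \<open>*s\<close> on a matrix takes a vector; hence an entrywise scaling.\<close>

definition cscale :: "complex \<Rightarrow> complex^'n^'m \<Rightarrow> complex^'n^'m" where
  "cscale a Y = (\<chi> i j. a * Y $ i $ j)"

lemma cscale_nth [simp]: "cscale a Y $ i $ j = a * Y $ i $ j"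
  by (simp add: cscale_def)

lemma cmat_mult: "cmat (X ** Y) = cmat X ** cmat Y"
  by (simp add: vec_eq_iff matrix_matrix_mult_def)

lemma matrix_mult_cscale: "M ** cscale a Y = cscale a (M ** Y)" "cscale a M ** N = cscale a (M ** N)"
  by (simp_all add: vec_eq_iff matrix_matrix_mult_def sum_distrib_left algebra_simps)

lemma matrix_add_rdistrib: "(X + Y) ** Z = X ** Z + Y ** (Z :: 'a::semiring_1^'n^'m)"
  by (simp add: vec_eq_iff matrix_matrix_mult_def distrib_right sum.distrib)

lemma linear_matrix_mult_left:
  "Vector_Spaces.linear cscale cscale ((**) (M :: complex^'n^'n) :: complex^'k^'n \<Rightarrow> _)"
  by unfold_locales (auto simp: vec_eq_iff algebra_simps matrix_add_ldistrib
      matrix_mult_cscale)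

lemma matrix_eq_column: "M ** Y = cscale \<mu> Y \<Longrightarrow> M *v column j Y = \<mu> *s column j Y"
  by (auto simp: vec_eq_iff matrix_matrix_mult_def matrix_vector_mult_def column_def)

lemma nonzero_matrix_column: "Y \<noteq> 0 \<Longrightarrow> \<exists>j. column j Y \<noteq> 0"
  by (auto simp: vec_eq_iff column_def)

text \<open>Any nonzero column of \<open>Z\<close> is an eigenvector of \<open>M\<close> for
  \<mu>.\<close>

lemma hurwitz_matrix_eigen:
  assumes "hurwitz M" "cmat M ** Z = cscale \<mu> Z" "Z \<noteq> 0"
  shows "Re \<mu> < 0"
  using assms matrix_eq_column nonzero_matrix_column unfolding hurwitz_def by blast

text \<open>Left multiplication by \<open>M\<close> preserves the kernel of the operator, so a nontrivial kernel contains
  an eigenvector \<open>Z\<close>, \<open>M Z = \<mu> Z\<close>. Then \<open>Z M\<^sup>T = -\<mu> Z\<close>, and both \<open>\<mu>\<close> and \<open>-\<mu>\<close> are eigenvalues of \<open>M\<close>.\<close>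

lemma hurwitz_lyap_injective:
  assumes M: "hurwitz M" and X: "M ** X + X ** transpose M = 0"
  shows "X = 0"
proof (rule ccontr)
  assume X0: "X \<noteq> 0"
  \<comment> \<open>The annihilating polynomial of \<open>X\<close> is found over the reals and then
    read with complex coefficients, where it has roots; \<open>?K\<close> is the kernel after
    complexification.\<close>
  obtain p :: "real poly" where p: "p \<noteq> 0" "(\<Sum>i\<le>degree p. coeff p i *\<^sub>R (((**) M) ^^ i) X) = 0"
    using linear_orbit_dependent by blast
  have it: "(((**) (cmat M)) ^^ i) (cmat X) = cmat ((((**) M) ^^ i) X)" for i
    by (induction i) (auto simp: cmat_mult)
  let ?p = "map_poly complex_of_real p"
  let ?K = "{Y. cmat M ** Y + Y ** transpose (cmat M) = 0}"
  have 1: "(\<Sum>i\<le>degree ?p. cscale (coeff ?p i) ((((**) (cmat M)) ^^ i) (cmat X))) = 0"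
  proof -
    have "(\<Sum>i\<le>degree ?p. cscale (coeff ?p i) ((((**) (cmat M)) ^^ i) (cmat X)))
      = cmat (\<Sum>i\<le>degree p. coeff p i *\<^sub>R (((**) M) ^^ i) X)"
      by (simp add: vec_eq_iff it coeff_map_poly degree_map_poly)
    also have "\<dots> = 0" by (simp add: p vec_eq_iff)
    finally show ?thesis .
  qed
  interpret L: Vector_Spaces.linear cscale cscale "(**) (cmat M) :: complex^'a^'a \<Rightarrow> _"
    by (rule linear_matrix_mult_left)
  have sub: "L.vs1.subspace ?K"
  proof (rule L.vs1.subspaceI)
    fix c x assume "x \<in> ?K"
    then have "cscale c (cmat M ** x + x ** transpose (cmat M)) = 0" by (simp add: vec_eq_iff)
    then show "cscale c x \<in> ?K"
      by (simp add: matrix_mult_cscale L.vs1.scale_right_distrib)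
  qed (auto simp: matrix_add_ldistrib matrix_add_rdistrib algebra_simps add_eq_0_iff2)
  have inv: "cmat M ** z \<in> ?K" if "z \<in> ?K" for z
  proof -
    have "cmat M ** (cmat M ** z + z ** transpose (cmat M)) = 0" using that by simp
    then show ?thesis by (simp add: matrix_add_ldistrib matrix_mul_assoc)
  qed
  have XK: "cmat X \<in> ?K"
  proof -
    have "cmat M ** cmat X + cmat X ** transpose (cmat M) = cmat (M ** X + X ** transpose M)"
      by (simp add: vec_eq_iff matrix_matrix_mult_def transpose_def)
    then show ?thesis using X by (simp add: vec_eq_iff)
  qed
  have "?p \<noteq> 0" using p by (simp add: map_poly_eq_0_iff)
  moreover have "cmat X \<noteq> 0" using X0 by (simp add: vec_eq_iff)
  ultimately obtain \<mu> Z where Z: "Z \<in> ?K" "Z \<noteq> 0" "cmat M ** Z = cscale \<mu> Z"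
    using poly_eigenvector[OF linear_matrix_mult_left sub inv _ 1 XK] by blast
  have "Re \<mu> < 0" using hurwitz_matrix_eigen[OF M Z(3,2)] .
  moreover have "Z ** transpose (cmat M) = cscale (- \<mu>) Z"
    using Z(1,3) by (simp add: add_eq_0_iff L.vs1.scale_minus_left)
  \<comment> \<open>Transposition turns the right eigenvalue relation for \<open>Z\<close> into a
    left one for \<open>transpose Z\<close>, to which the Hurwitz property applies again.\<close>
  then have "transpose (Z ** transpose (cmat M)) = cscale (- \<mu>) (transpose Z)"
    by (simp add: vec_eq_iff transpose_def)
  then have "cmat M ** transpose Z = cscale (- \<mu>) (transpose Z)"
    by (simp add: matrix_transpose_mul)
  then have "Re (- \<mu>) < 0"
    using hurwitz_matrix_eigen[OF M] Z(2) by (metis transpose_transpose transpose_mat mat_0)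
  ultimately show False by simp
qed

section \<open>Lyapunov equations and the derivative of the quadratic cost\<close>

lemma bounded_bilinear_matrix_mult:
  "bounded_bilinear ((**) :: real^'b^'a \<Rightarrow> real^'c^'b \<Rightarrow> real^'c^'a)"
proof -
  have "bilinear ((**) :: real^'b^'a \<Rightarrow> real^'c^'b \<Rightarrow> real^'c^'a)"
    unfolding bilinear_def
    by (auto intro!: linearI simp: matrix_add_ldistrib matrix_add_rdistrib
        scalar_matrix_assoc matrix_scalar_ac simp flip: scalar_mult_eq_scaleR)
  then show ?thesis by (simp add: bilinear_conv_bounded_bilinear)
qed

text \<open>This supplies the product rule \<open>mm.FDERIV\<close> along with additivity and
  homogeneity in both factors.\<close>

interpretation mm: bounded_bilinear "(**) :: real^'b^'a \<Rightarrow> real^'c^'b \<Rightarrow> real^'c^'a"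
  by (rule bounded_bilinear_matrix_mult)

section \<open>Adjoints of matrix multiplications in the Frobenius inner product\<close>

lemma transpose_add: "transpose (X + Y :: real^'n^'m) = transpose X + transpose Y"
  and transpose_diff: "transpose (X - Y :: real^'n^'m) = transpose X - transpose Y"
  and transpose_minus: "transpose (- X :: real^'n^'m) = - transpose X"
  and transpose_zero: "transpose (0 :: real^'n^'m) = 0"
  by (simp_all add: vec_eq_iff transpose_def)

lemma bounded_linear_transpose: "bounded_linear (transpose :: real^'n^'m \<Rightarrow> real^'m^'n)"
  unfolding linear_conv_bounded_linear[symmetric]
  by (auto intro!: linearI simp: transpose_add transpose_scalar)

lemma inner_transpose: "inner (transpose X) Y = inner (X :: real^'n^'m) (transpose Y)"
  unfolding inner_vec_def transpose_def by (simp add: sum.swap[of _ UNIV "UNIV::'n set"])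

text \<open>Both sides are the same triple sum; only the order of summation differs.\<close>

lemma inner_mult_right: "inner X (Y ** Z) = inner (transpose Y ** X) (Z :: real^'n^'m)"
proof -
  have "inner X (Y ** Z) = (\<Sum>i\<in>UNIV. \<Sum>j\<in>UNIV. \<Sum>k\<in>UNIV. X$i$j * (Y$i$k * Z$k$j))"
    by (simp add: inner_vec_def matrix_matrix_mult_def sum_distrib_left)
  also have "\<dots> = (\<Sum>i\<in>UNIV. \<Sum>k\<in>UNIV. \<Sum>j\<in>UNIV. X$i$j * (Y$i$k * Z$k$j))"
    by (intro sum.cong refl sum.swap)
  also have "\<dots> = (\<Sum>k\<in>UNIV. \<Sum>i\<in>UNIV. \<Sum>j\<in>UNIV. X$i$j * (Y$i$k * Z$k$j))"
    by (rule sum.swap)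
  also have "\<dots> = (\<Sum>k\<in>UNIV. \<Sum>j\<in>UNIV. \<Sum>i\<in>UNIV. X$i$j * (Y$i$k * Z$k$j))"
    by (intro sum.cong refl sum.swap)
  also have "\<dots> = inner (transpose Y ** X) Z"
    by (simp add: inner_vec_def matrix_matrix_mult_def sum_distrib_left sum_distrib_right transpose_def algebra_simps)
  finally show ?thesis .
qed

text \<open>Transposition is an isometry that exchanges left and right multiplication.\<close>

lemma inner_mult_left: "inner X (Y ** Z) = inner (X ** transpose Z) (Y :: real^'n^'m)"
proof -
  have "inner X (Y ** Z) = inner (transpose X) (transpose Z ** transpose Y)"
    by (metis inner_transpose matrix_transpose_mul transpose_transpose)
  also have "\<dots> = inner (transpose (X ** transpose Z)) (transpose Y)"
    by (simp add: inner_mult_right matrix_transpose_mul)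
  finally show ?thesis by (simp add: inner_transpose)
qed

section \<open>The Lyapunov operator, its solutions and their perturbation\<close>

definition lyap_op :: "real^'n^'n \<Rightarrow> real^'n^'n \<Rightarrow> real^'n^'n" where
  "lyap_op M X = M ** X + X ** transpose M"

lemma linear_lyap_op: "linear (lyap_op M)"
  by (auto intro!: linearI simp: lyap_op_def mm.add_left mm.add_right mm.scaleR_left mm.scaleR_right algebra_simps)

lemma lyap_op_diff_left: "lyap_op (M - N) X = lyap_op M X - lyap_op N X"
  by (simp add: lyap_op_def mm.diff_left mm.diff_right transpose_diff)

lemma transpose_lyap_op: "transpose (lyap_op M X) = lyap_op M (transpose X)"
  by (simp add: lyap_op_def transpose_add matrix_transpose_mul add.commute)

lemma inner_lyap_op: "inner X (lyap_op M Y) = inner (lyap_op (transpose M) X) Y"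
  by (simp add: lyap_op_def inner_add_left inner_add_right inner_mult_right[of X M] inner_mult_left[of X Y])

text \<open>In finite dimension an injective operator is surjective, so \<open>THE\<close> in
  \<open>lyap\<close> picks a genuine unique solution. Injectivity is assumed instead of
  \<open>hurwitz\<close> because it is readily shown to survive perturbation.\<close>

lemma lyap_unique:
  assumes "inj (lyap_op M)"
  shows lyap_solves: "lyap_op M (lyap M N) = - N"
    and lyap_eqI: "lyap_op M X = - N \<Longrightarrow> lyap M N = X"
proof -
  have "surj (lyap_op M)"
    using linear_injective_imp_surjective[OF linear_lyap_op assms] by simp
  then obtain Y where Y: "lyap_op M Y = - N" by (metis surjD)
  have "\<exists>!X. M ** X + X ** transpose M + N = 0"
  proof (rule ex1I[of _ Y])
    show "M ** Y + Y ** transpose M + N = 0" using Y by (simp add: lyap_op_def)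
  next
    fix X assume "M ** X + X ** transpose M + N = 0"
    then have "lyap_op M X = - N" by (simp add: lyap_op_def add_eq_0_iff2)
    then show "X = Y" using Y assms by (metis injD)
  qed
  from theI'[OF this] show *: "lyap_op M (lyap M N) = - N"
    by (simp add: lyap_def lyap_op_def add_eq_0_iff2)
  show "lyap M N = X" if "lyap_op M X = - N"
    using * that assms by (metis injD)
qed

lemma lyap_symmetric:
  assumes "inj (lyap_op M)" "transpose N = N"
  shows "transpose (lyap M N) = lyap M N"
  by (metis assms lyap_eqI lyap_solves transpose_lyap_op transpose_minus)

text \<open>By \<open>inner_lyap_op\<close> the operator of \<open>transpose M\<close> is the
  adjoint of a surjective operator, hence injective. This makes the observability Gramian well
  defined.\<close>

lemma inj_lyap_op_transpose:
  assumes "inj (lyap_op M)"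
  shows "inj (lyap_op (transpose M))"
proof -
  have "X = 0" if "lyap_op (transpose M) X = 0" for X
  proof -
    obtain Y where "X = lyap_op M Y"
      using linear_injective_imp_surjective[OF linear_lyap_op assms] by (metis surjD)
    then have "inner X X = inner (lyap_op (transpose M) X) Y" by (metis inner_lyap_op)
    then show "X = 0" using that by simp
  qed
  then show ?thesis by (simp add: linear_injective_0[OF linear_lyap_op])
qed

lemma lyap_op_norm_bound: "\<exists>K>0. \<forall>M X. norm (lyap_op M X :: real^'n^'n) \<le> K * norm M * norm X"
proof -
  have "bilinear (lyap_op :: real^'n^'n \<Rightarrow> _)"
    by (auto simp: bilinear_def linear_lyap_op intro!: linearI)
      (auto simp: lyap_op_def mm.add_left mm.add_right mm.scaleR_left mm.scaleR_right transpose_add transpose_scalar algebra_simps)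
  then have "bounded_bilinear (lyap_op :: real^'n^'n \<Rightarrow> _)"
    by (simp add: bilinear_conv_bounded_bilinear)
  from bounded_bilinear.pos_bounded[OF this] show ?thesis
    by (metis mult.assoc mult.commute)
qed

text \<open>An injective operator is bounded below by some \<open>k\<close>. A perturbation of
  operator norm at most k/2 leaves the bound k/2, and the error of the solution satisfies a Lyapunov
  equation with small right-hand side.\<close>

lemma lyap_tendsto:
  fixes M :: "'v \<Rightarrow> real^'n^'n"
  assumes inj: "inj (lyap_op M0)"
    and M: "(M \<longlongrightarrow> M0) F" and N: "(N \<longlongrightarrow> N0) F"
  shows eventually_inj_lyap_op: "\<forall>\<^sub>F y in F. inj (lyap_op (M y))"
    and "((\<lambda>y. lyap (M y) (N y)) \<longlongrightarrow> lyap M0 N0) F"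
proof -
  obtain k where k: "k > 0" "\<And>X. k * norm X \<le> norm (lyap_op M0 X)"
    using linear_inj_bounded_below_pos[OF linear_lyap_op inj] by blast
  obtain K where K: "K > 0" "\<And>M X. norm (lyap_op M X :: real^'n^'n) \<le> K * norm M * norm X"
    using lyap_op_norm_bound by blast
  \<comment> \<open>With this radius \<open>lyap_op (M y - M0)\<close> has norm at most k/2.\<close>
  have "\<forall>\<^sub>F y in F. dist (M y) M0 < k / (2 * K)"
    using M k(1) K(1) by (intro tendstoD) auto
  then have close: "\<forall>\<^sub>F y in F. K * norm (M y - M0) \<le> k / 2"
    by eventually_elim (use K(1) in \<open>auto simp: dist_norm field_simps\<close>)
  have below: "k / 2 * norm X \<le> norm (lyap_op M' X)" if "K * norm (M' - M0) \<le> k / 2" for M' X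
  proof -
    have "norm (lyap_op (M' - M0) X) \<le> K * norm (M' - M0) * norm X" by (rule K)
    also have "\<dots> \<le> k / 2 * norm X" using that by (rule mult_right_mono) simp
    finally have "norm (lyap_op M' X - lyap_op M0 X) \<le> k / 2 * norm X"
      by (simp add: lyap_op_diff_left)
    moreover have "norm (lyap_op M0 X) \<le> norm (lyap_op M' X) + norm (lyap_op M' X - lyap_op M0 X)"
      by (metis norm_minus_commute norm_triangle_sub)
    ultimately show ?thesis using k(2)[of X] by linarith
  qed
  have injM: "inj (lyap_op M')" if "K * norm (M' - M0) \<le> k / 2" for M'
    unfolding linear_injective_0[OF linear_lyap_op]
  proof (intro allI impI)
    fix X assume "lyap_op M' X = 0"
    then have "k / 2 * norm X \<le> 0" using below[OF that, of X] by simp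
    then show "X = 0" using k(1) by (simp add: mult_le_0_iff)
  qed
  show "\<forall>\<^sub>F y in F. inj (lyap_op (M y))"
    using close by eventually_elim (rule injM)
  have aux: "s \<le> 2 / k * t" if "k / 2 * s \<le> t" for s t :: real
    using that k(1) by (simp add: field_simps)
  have cancel: "- a - c = - (a - b) - (c - - b)" for a b c :: "real^'n^'n"
    by (simp add: algebra_simps)
  let ?Z = "lyap M0 N0"
  have "\<forall>\<^sub>F y in F. norm (lyap (M y) (N y) - ?Z) \<le> 2 / k * (norm (N y - N0) + K * norm (M y - M0) * norm ?Z)"
    using close
  proof eventually_elim
    case (elim y)
    let ?P = "lyap (M y) (N y)"
    \<comment> \<open>The equation for the error: its right-hand side contains only the differences
      N y - N0 and M y - M0.\<close>
    have "lyap_op (M y) (?P - ?Z) = - N y - lyap_op (M y) ?Z"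
      unfolding linear_diff[OF linear_lyap_op] lyap_solves[OF injM[OF elim]] by (rule refl)
    also have "\<dots> = - (N y - N0) - lyap_op (M y - M0) ?Z"
      unfolding lyap_op_diff_left lyap_solves[OF inj] by (rule cancel)
    finally have "norm (lyap_op (M y) (?P - ?Z)) = norm (- (N y - N0) - lyap_op (M y - M0) ?Z)"
      by (rule arg_cong)
    also have "\<dots> \<le> norm (N y - N0) + norm (lyap_op (M y - M0) ?Z)"
      using norm_triangle_ineq4[of "- (N y - N0)"] by (simp only: norm_minus_cancel)
    also have "\<dots> \<le> norm (N y - N0) + K * norm (M y - M0) * norm ?Z"
      using K(2) by simp
    finally have "k / 2 * norm (?P - ?Z) \<le> norm (N y - N0) + K * norm (M y - M0) * norm ?Z"
      using below[OF elim, of "?P - ?Z"] by (rule order_trans[rotated])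
    then show ?case by (rule aux)
  qed
  moreover have "((\<lambda>y. 2 / k * (norm (N y - N0) + K * norm (M y - M0) * norm ?Z)) \<longlongrightarrow> 0) F"
    by (intro tendsto_mult_right_zero tendsto_add_zero tendsto_mult_left_zero tendsto_norm_zero
        LIM_zero M N)
  ultimately have "((\<lambda>y. lyap (M y) (N y) - ?Z) \<longlongrightarrow> 0) F"
    by (rule Lim_null_comparison)
  then show "((\<lambda>y. lyap (M y) (N y)) \<longlongrightarrow> lyap M0 N0) F"
    by (simp add: LIM_zero_iff)
qed

text \<open>The product rule would add the pairing of \<open>f x\<close> with the derivative of
  \<open>g\<close>. As \<open>f x\<close> is zero, continuity of \<open>g\<close> suffices: f y is
  O(|y - x|) and g y - g x tends to 0.\<close>

lemma has_derivative_inner_vanishing: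
  fixes f g :: "'v::real_normed_vector \<Rightarrow> 'w::real_inner"
  assumes f: "(f has_derivative f') (at x)" and fx: "f x = 0" and g: "isCont g x"
  shows "((\<lambda>y. inner (f y) (g y)) has_derivative (\<lambda>h. inner (f' h) (g x))) (at x)"
proof -
  interpret f': bounded_linear f' using f by (rule has_derivative_bounded_linear)
  obtain K where K: "\<And>h. norm (f' h) \<le> norm h * K" using f'.bounded by blast
  have aux: "a / n \<le> R * m" if "a \<le> R * n * m" "n > 0" for a n R m :: real
    using that by (simp add: pos_divide_le_eq mult_ac)
  let ?r = "\<lambda>y. norm (f y - f' (y - x)) / norm (y - x)"
  have r: "(?r \<longlongrightarrow> 0) (at x)"
  proof -
    have "((\<lambda>y. (f y - f x - f' (y - x)) /\<^sub>R norm (y - x)) \<longlongrightarrow> 0) (at x)"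
      using f unfolding has_derivative_at_within by blast
    from tendsto_norm_zero[OF this] show ?thesis
      by (simp add: fx divide_inverse_commute)
  qed
  have "((\<lambda>y. inner (f y) (g y) - inner (f y) (g x)) has_derivative (\<lambda>h. 0)) (at x)"
    unfolding has_derivative_at_within
  proof (intro conjI bounded_linear_zero)
    have "\<forall>\<^sub>F y in at x. norm ((inner (f y) (g y) - inner (f y) (g x) - (inner (f x) (g x) - inner (f x) (g x)) - 0) /\<^sub>R norm (y - x))
        \<le> (?r y + K) * norm (g y - g x)"
      unfolding eventually_at_filter
    proof (intro always_eventually allI impI)
      fix y assume y: "y \<noteq> x"
      have "norm (f y) \<le> norm (f y - f' (y - x)) + norm (f' (y - x))"
        by (metis add.commute norm_triangle_sub)
      also have "\<dots> \<le> norm (f y - f' (y - x)) + norm (y - x) * K" using K by simp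
      also have "\<dots> = (?r y + K) * norm (y - x)" using y by (simp add: field_simps)
      finally have "norm (f y) \<le> (?r y + K) * norm (y - x)" .
      then have "norm (f y) * norm (g y - g x) \<le> (?r y + K) * norm (y - x) * norm (g y - g x)"
        by (rule mult_right_mono) simp
      then have "\<bar>inner (f y) (g y - g x)\<bar> \<le> (?r y + K) * norm (y - x) * norm (g y - g x)"
        by (rule order_trans[OF Cauchy_Schwarz_ineq2])
      then have "\<bar>inner (f y) (g y - g x)\<bar> / norm (y - x) \<le> (?r y + K) * norm (g y - g x)"
        by (rule aux) (use y in simp)
      then show "norm ((inner (f y) (g y) - inner (f y) (g x) - (inner (f x) (g x) - inner (f x) (g x)) - 0) /\<^sub>R norm (y - x))
        \<le> (?r y + K) * norm (g y - g x)"
        by (simp only: inner_diff_right divide_inverse_commute norm_scaleR diff_self diff_zero real_norm_def real_scaleR_def abs_mult abs_inverse abs_norm_cancel)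
    qed
    moreover have "((\<lambda>y. (?r y + K) * norm (g y - g x)) \<longlongrightarrow> (0 + K) * 0) (at x)"
      using g unfolding isCont_def
      by (intro tendsto_mult tendsto_add r tendsto_const tendsto_norm_zero LIM_zero)
    then have "((\<lambda>y. (?r y + K) * norm (g y - g x)) \<longlongrightarrow> 0) (at x)"
      by (simp only: mult_zero_right)
    ultimately show "((\<lambda>y. (inner (f y) (g y) - inner (f y) (g x) - (inner (f x) (g x) - inner (f x) (g x)) - 0) /\<^sub>R norm (y - x)) \<longlongrightarrow> 0) (at x)"
      by (rule Lim_null_comparison)
  qed
  moreover have "((\<lambda>y. inner (f y) (g x)) has_derivative (\<lambda>h. inner (f' h) (g x))) (at x)"
    using f by (auto intro!: derivative_eq_intros)
  ultimately show ?thesis by (auto dest: has_derivative_add)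
qed

lemma lqg_has_derivative:
  fixes A :: "'v::real_normed_vector \<Rightarrow> real^'k^'k" and B :: "'v \<Rightarrow> real^'m^'k" and C :: "'v \<Rightarrow> real^'k^'r"
  assumes A: "(A has_derivative A') (at x)" and B: "(B has_derivative B') (at x)"
    and C: "(C has_derivative C') (at x)"
    and inj: "inj (lyap_op (A x))"
    and P: "P = ctrl_gram (A x) (B x)" and Q: "Q = obs_gram (A x) (C x)"
  shows "((\<lambda>y. (1/2) * inner (transpose (C y) ** C y) (ctrl_gram (A y) (B y))) has_derivative
    (\<lambda>h. inner (C' h) (C x ** P) + inner (B' h) (Q ** B x) + inner (A' h) (Q ** P))) (at x)"
proof -
  note injT = inj_lyap_op_transpose[OF inj]
  define S where "S y = transpose (C y) ** C y" for y
  define N where "N y = B y ** transpose (B y)" for y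
  \<comment> \<open>By the observability equation \<open>SQ\<close> this equals S y +
    \<open>lyap_op (transpose (A y)) Q\<close>; written with differences, it visibly vanishes at
    \<open>x\<close>.\<close>
  define \<Phi> where "\<Phi> y = S y - S x + lyap_op (transpose (A y - A x)) Q" for y
  define p where "p y = lyap (A y) (N y)" for y
  note tr = bounded_linear.has_derivative[OF bounded_linear_transpose]
  have dS: "(S has_derivative (\<lambda>h. transpose (C x) ** C' h + transpose (C' h) ** C x)) (at x)"
    unfolding S_def by (intro mm.FDERIV tr C)
  have dN: "(N has_derivative (\<lambda>h. B x ** transpose (B' h) + B' h ** transpose (B x))) (at x)"
    unfolding N_def by (intro mm.FDERIV tr B)
  have d\<Phi>: "(\<Phi> has_derivative (\<lambda>h. transpose (C x) ** C' h + transpose (C' h) ** C x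
      + lyap_op (transpose (A' h)) Q)) (at x)"
    unfolding \<Phi>_def lyap_op_def transpose_transpose
    by (rule derivative_eq_intros dS A tr mm.FDERIV | simp)+
  have pc: "isCont p x"
    unfolding isCont_def p_def
    using has_derivative_continuous[OF A] has_derivative_continuous[OF dN]
    by (intro lyap_tendsto inj) (auto simp: continuous_within)
  have symP: "transpose P = P"
    unfolding P ctrl_gram_def by (intro lyap_symmetric inj) (simp add: matrix_transpose_mul)
  have symQ: "transpose Q = Q"
    unfolding Q obs_gram_def by (intro lyap_symmetric injT) (simp add: matrix_transpose_mul)
  have SQ: "lyap_op (transpose (A x)) Q = - S x"
    unfolding Q obs_gram_def S_def by (rule lyap_solves[OF injT])
  have px: "p x = P" by (simp add: p_def P N_def ctrl_gram_def)
  \<comment> \<open>Duality: moving the Lyapunov operator from \<open>Q\<close> to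
    \<open>p y\<close> produces - N y, for every \<open>y\<close> at which the Gramian
    exists.\<close>
  have *: "inner (S y) (p y) = inner (\<Phi> y) (p y) + inner Q (N y)" if "inj (lyap_op (A y))" for y
  proof -
    have "inner (lyap_op (transpose (A y)) Q) (p y) = inner Q (lyap_op (A y) (p y))"
      by (simp add: inner_lyap_op)
    also have "\<dots> = - inner Q (N y)" by (simp add: p_def lyap_solves[OF that])
    finally show ?thesis
      by (simp add: \<Phi>_def transpose_diff lyap_op_diff_left SQ inner_add_left inner_diff_left)
  qed
  \<comment> \<open>Injectivity concerns \<open>A\<close> alone, so the inhomogeneity in
    \<open>lyap_tendsto\<close> is set to zero.\<close>
  have ev: "\<forall>\<^sub>F y in at x. inj (lyap_op (A y))"
    using has_derivative_continuous[OF A]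
    by (intro eventually_inj_lyap_op[OF inj, of _ _ "\<lambda>_. 0" 0]) (auto simp: continuous_within)
  have "((\<lambda>y. (1/2) * (inner (\<Phi> y) (p y) + inner Q (N y))) has_derivative
     (\<lambda>h. (1/2) * (inner (transpose (C x) ** C' h + transpose (C' h) ** C x
      + lyap_op (transpose (A' h)) Q) P + inner Q (B x ** transpose (B' h) + B' h ** transpose (B x))))) (at x)"
    unfolding px[symmetric]
    by (intro has_derivative_mult_right has_derivative_add has_derivative_inner_vanishing[OF d\<Phi> _ pc]
       bounded_linear.has_derivative[OF bounded_linear_inner_right] dN)
      (simp add: \<Phi>_def lyap_op_def transpose_zero)
  then have "((\<lambda>y. (1/2) * inner (S y) (p y)) has_derivative
     (\<lambda>h. (1/2) * (inner (transpose (C x) ** C' h + transpose (C' h) ** C x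
      + lyap_op (transpose (A' h)) Q) P + inner Q (B x ** transpose (B' h) + B' h ** transpose (B x))))) (at x)"
    by (rule has_derivative_transform_eventually[where x = x and s = UNIV])
      (use ev * inj in \<open>auto elim!: eventually_mono\<close>)
  \<comment> \<open>By symmetry of \<open>P\<close> and \<open>Q\<close> the terms are equal in
    pairs, which absorbs the factor 1/2.\<close>
  moreover have "(1/2) * (inner (transpose (C x) ** C' h + transpose (C' h) ** C x
      + lyap_op (transpose (A' h)) Q) P + inner Q (B x ** transpose (B' h) + B' h ** transpose (B x)))
    = inner (C' h) (C x ** P) + inner (B' h) (Q ** B x) + inner (A' h) (Q ** P)" for h
  proof -
    have c1: "inner (transpose (C x) ** C' h) P = inner (C' h) (C x ** P)"
      by (simp add: inner_mult_right)
    have c2: "inner (transpose (C' h) ** C x) P = inner (C' h) (C x ** P)"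
      by (metis c1 inner_transpose matrix_transpose_mul symP transpose_transpose)
    have b1: "inner Q (B' h ** transpose (B x)) = inner (B' h) (Q ** B x)"
      by (metis inner_commute inner_mult_left transpose_transpose)
    have b2: "inner Q (B x ** transpose (B' h)) = inner (B' h) (Q ** B x)"
      by (metis b1 inner_transpose matrix_transpose_mul symQ transpose_transpose)
    have a1: "inner (transpose (A' h) ** Q) P = inner (A' h) (Q ** P)"
      by (metis inner_commute inner_mult_left inner_mult_right symP transpose_transpose)
    have a2: "inner (Q ** A' h) P = inner (A' h) (Q ** P)"
      by (metis inner_commute inner_mult_right symQ transpose_transpose)
    show ?thesis
      by (simp add: lyap_op_def inner_add_left inner_add_right a1 a2 b1 b2 c1 c2)
  qed
  ultimately show ?thesis
    by (simp only: S_def p_def N_def ctrl_gram_def)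
qed

section \<open>Block matrices\<close>

lemma hcat_nth [simp]: "hcat M N $ i $ Inl k = M $ i $ k" "hcat M N $ i $ Inr l = N $ i $ l"
  by (simp_all add: hcat_def)

lemma vcat_nth [simp]: "vcat M N $ Inl k = M $ k" "vcat M N $ Inr l = N $ l"
  by (simp_all add: vcat_def)

lemma sum_UNIV_Plus:
  fixes f :: "'a::finite + 'b::finite \<Rightarrow> 'c::comm_monoid_add"
  shows "sum f UNIV = (\<Sum>i\<in>UNIV. f (Inl i)) + (\<Sum>j\<in>UNIV. f (Inr j))"
  unfolding UNIV_Plus_UNIV[symmetric] by (subst sum.Plus) auto

text \<open>The upper part of an eigenvector is an eigenvector of \<open>M\<close> unless it
  vanishes, and then the lower part is one of \<open>N\<close>.\<close>

lemma hurwitz_block_triangular: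
  fixes M :: "real^'n^'n" and N :: "real^'m^'m" and L :: "real^'n^'m"
  assumes "hurwitz M" "hurwitz N"
  shows "hurwitz (vcat (hcat M 0) (hcat L N))"
  unfolding hurwitz_def
proof (intro allI impI, elim conjE)
  fix z :: complex and v :: "complex^('n + 'm)"
  assume v: "v \<noteq> 0" and eig: "map_matrix complex_of_real (vcat (hcat M 0) (hcat L N)) *v v = z *s v"
  define v1 where "v1 = (\<chi> i. v $ Inl i)"
  define v2 where "v2 = (\<chi> i. v $ Inr i)"
  have row: "(map_matrix complex_of_real (vcat (hcat M 0) (hcat L N)) *v v) $ i = (z *s v) $ i" for i
    by (simp add: eig)
  have 1: "map_matrix complex_of_real M *v v1 = z *s v1"
    using row[of "Inl _"] by (simp add: vec_eq_iff matrix_vector_mult_def sum_UNIV_Plus v1_def)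
  show "Re z < 0"
  proof (cases "v1 = 0")
    case True
    then have "v $ Inl i = 0" for i by (simp add: v1_def vec_eq_iff)
    moreover have "v2 \<noteq> 0"
    proof
      assume "v2 = 0"
      then have "v $ Inr i = 0" for i by (simp add: v2_def vec_eq_iff)
      with \<open>\<And>i. v $ Inl i = 0\<close> have "v $ i = 0" for i by (cases i) simp_all
      then show False using v by (simp add: vec_eq_iff)
    qed
    moreover have "map_matrix complex_of_real N *v v2 = z *s v2"
      using row[of "Inr _"] \<open>\<And>i. v $ Inl i = 0\<close>
      by (simp add: vec_eq_iff matrix_vector_mult_def sum_UNIV_Plus v2_def)
    ultimately show ?thesis using assms(2) unfolding hurwitz_def by blast
  next
    case False
    with 1 show ?thesis using assms(1) unfolding hurwitz_def by blast
  qed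
qed

lemma has_derivative_hcat:
  fixes f :: "'v::real_normed_vector \<Rightarrow> real^'a^'r" and g :: "'v \<Rightarrow> real^'b^'r"
  assumes "(f has_derivative f') (at x)" "(g has_derivative g') (at x)"
  shows "((\<lambda>y. hcat (f y) (g y)) has_derivative (\<lambda>h. hcat (f' h) (g' h))) (at x)"
proof -
  have "bounded_linear (\<lambda>p. hcat (fst p) (snd p) :: real^('a + 'b)^'r)"
    unfolding linear_conv_bounded_linear[symmetric]
    by (intro linearI) (auto simp: vec_eq_iff hcat_def split: sum.splits)
  from bounded_linear.has_derivative[OF this has_derivative_Pair[OF assms]] show ?thesis by simp
qed

lemma has_derivative_vcat:
  fixes f :: "'v::real_normed_vector \<Rightarrow> real^'r^'a" and g :: "'v \<Rightarrow> real^'r^'b"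
  assumes "(f has_derivative f') (at x)" "(g has_derivative g') (at x)"
  shows "((\<lambda>y. vcat (f y) (g y)) has_derivative (\<lambda>h. vcat (f' h) (g' h))) (at x)"
proof -
  have "bounded_linear (\<lambda>p. vcat (fst p) (snd p) :: real^'r^('a + 'b))"
    unfolding linear_conv_bounded_linear[symmetric]
    by (intro linearI) (auto simp: vec_eq_iff vcat_def split: sum.splits)
  from bounded_linear.has_derivative[OF this has_derivative_Pair[OF assms]] show ?thesis by simp
qed

lemma inner_blocks:
  "inner (vcat (hcat X Y) (hcat Z W)) M
    = inner X (blk11 M) + inner Y (blk12 M) + inner Z (blk21 M) + inner W (blk22 M)"
  by (simp add: inner_vec_def sum_UNIV_Plus blk11_def blk12_def blk21_def blk22_def sum.distrib)

lemma blk_vcat_hcat [simp]: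
  "blk11 (vcat (hcat X Y) (hcat Z W)) = X" "blk12 (vcat (hcat X Y) (hcat Z W)) = Y"
  "blk21 (vcat (hcat X Y) (hcat Z W)) = Z" "blk22 (vcat (hcat X Y) (hcat Z W)) = W"
  by (simp_all add: vec_eq_iff blk11_def blk12_def blk21_def blk22_def)

lemma blk_mult:
  "blk11 (M ** N) = blk11 M ** blk11 N + blk12 M ** blk21 N"
  "blk12 (M ** N) = blk11 M ** blk12 N + blk12 M ** blk22 N"
  "blk21 (M ** N) = blk21 M ** blk11 N + blk22 M ** blk21 N"
  "blk22 (M ** N) = blk21 M ** blk12 N + blk22 M ** blk22 N"
  by (simp_all add: vec_eq_iff matrix_matrix_mult_def sum_UNIV_Plus blk11_def blk12_def blk21_def blk22_def)

lemma blk_transpose: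
  "blk12 (transpose M) = transpose (blk21 M)" "blk22 (transpose M) = transpose (blk22 M)"
  by (simp_all add: vec_eq_iff transpose_def blk12_def blk21_def blk22_def)

text \<open>Made for the derivative of \<open>cl_C\<close> in \<open>b\<close>, whose left block is
  zero.\<close>

lemma inner_hcat_0_left:
  "inner (hcat 0 Y) (hcat X W ** M) = inner Y (X ** blk12 M + W ** blk22 M)"
  by (simp add: inner_vec_def sum_UNIV_Plus blk12_def blk22_def matrix_matrix_mult_def)

section \<open>The antisymmetric form, the constraint and the dependence of \<open>c\<close> on
  \<open>b\<close>\<close>

lemma transpose_symp: "transpose symp = - (symp :: real^('k::finite \<times> 2)^('k \<times> 2))"
proof -
  define J :: "real^2^2" where "J = vector [vector [0, 1], vector [-1, 0]]"
  have J: "J $ s $ t = - J $ t $ s" for s t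
    using exhaust_2[of s] exhaust_2[of t] by (auto simp: J_def)
  have "transpose symp $ i $ j = (- symp) $ i $ j" for i j :: "'k \<times> 2"
    unfolding symp_def J_def[symmetric] using J[of "snd j" "snd i"]
    by (simp add: kron_def transpose_def mat_def)
  then show ?thesis by (simp add: vec_eq_iff)
qed

text \<open>The two terms of the product rule contribute equally, because transposition changes the
  sign of both \<open>\<Lambda>\<close> and \<open>symp\<close>; the minus sign comes from moving
  \<open>\<Lambda>\<close> across the inner product.\<close>

lemma symp_quadratic_has_derivative:
  fixes f :: "'v::real_normed_vector \<Rightarrow> real^('k::finite \<times> 2)^'n"
  assumes f: "(f has_derivative f') (at x)" and \<Lambda>: "transpose \<Lambda> = - \<Lambda>"
  shows "((\<lambda>y. (1/2) * inner \<Lambda> (f y ** symp ** transpose (f y))) has_derivative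
     (\<lambda>h. - inner (f' h) (\<Lambda> ** f x ** symp))) (at x)"
proof -
  have "((\<lambda>y. f y ** (symp ** transpose (f y))) has_derivative
     (\<lambda>h. f x ** (symp ** transpose (f' h)) + f' h ** (symp ** transpose (f x)))) (at x)"
    by (rule mm.FDERIV[OF f bounded_linear.has_derivative[OF mm.bounded_linear_right
        bounded_linear.has_derivative[OF bounded_linear_transpose f]]])
  then have "((\<lambda>y. (1/2) * inner \<Lambda> (f y ** (symp ** transpose (f y)))) has_derivative
     (\<lambda>h. (1/2) * inner \<Lambda> (f x ** (symp ** transpose (f' h)) + f' h ** (symp ** transpose (f x))))) (at x)"
    by (rule has_derivative_mult_right[OF bounded_linear.has_derivative[OF bounded_linear_inner_right]])
  moreover have "(1/2) * inner \<Lambda> (f x ** (symp ** transpose (f' h)) + f' h ** (symp ** transpose (f x)))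
     = - inner (f' h) (\<Lambda> ** f x ** symp)" for h
  proof -
    have 1: "inner \<Lambda> (f x ** (symp ** transpose (f' h))) = - inner (f' h) (\<Lambda> ** f x ** symp)"
    proof -
      have "inner \<Lambda> (f x ** symp ** transpose (f' h)) = inner (\<Lambda> ** f' h) (f x ** symp)"
        unfolding inner_mult_left[of \<Lambda> "f x ** symp" "transpose (f' h)"] by simp
      also have "\<dots> = inner (f x ** symp) (\<Lambda> ** f' h)" by (rule inner_commute)
      also have "\<dots> = - inner (\<Lambda> ** (f x ** symp)) (f' h)"
        unfolding inner_mult_right[of "f x ** symp" \<Lambda> "f' h"] \<Lambda> by (simp add: mm.minus_left)
      finally show ?thesis by (simp add: matrix_mul_assoc inner_commute[of "f' h"])
    qed
    have "inner \<Lambda> (f' h ** (symp ** transpose (f x)))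
      = inner (transpose \<Lambda>) (transpose (f' h ** (symp ** transpose (f x))))"
      by (simp add: inner_transpose)
    also have "\<dots> = inner \<Lambda> (f x ** (symp ** transpose (f' h)))"
      by (simp add: \<Lambda> matrix_transpose_mul transpose_symp mm.minus_left mm.minus_right matrix_mul_assoc)
    finally show ?thesis by (simp add: 1 inner_add_right)
  qed
  ultimately show ?thesis by (simp only: matrix_mul_assoc)
qed

lemma bounded_linear_ctrl_c: "bounded_linear (ctrl_c d \<Theta>)"
  unfolding linear_conv_bounded_linear[symmetric]
  by (intro linearI) (auto simp: ctrl_c_def transpose_add transpose_scalar mm.add_left mm.add_right
      mm.scaleR_left mm.scaleR_right)

text \<open>The adjoint of \<open>ctrl_c\<close>: it converts a gradient \<open>K\<close> in
  \<open>c\<close> into a gradient in \<open>b\<close>.\<close>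

lemma inner_ctrl_c:
  "inner (ctrl_c d \<Theta> h) K = inner h (matrix_inv \<Theta> ** transpose K ** d ** symp)"
proof -
  have "inner (ctrl_c d \<Theta> h) K = inner K (d ** symp ** transpose h ** matrix_inv \<Theta>)"
    by (simp only: ctrl_c_def inner_commute)
  also have "\<dots> = inner (K ** transpose (matrix_inv \<Theta>)) (d ** symp ** transpose h)"
    by (rule inner_mult_left)
  also have "\<dots> = inner (transpose (d ** symp) ** (K ** transpose (matrix_inv \<Theta>))) (transpose h)"
    by (rule inner_mult_right)
  also have "\<dots> = inner (matrix_inv \<Theta> ** transpose K ** d ** symp) h"
    unfolding inner_transpose[symmetric] by (simp add: matrix_transpose_mul matrix_mul_assoc)
  also have "\<dots> = inner h (matrix_inv \<Theta> ** transpose K ** d ** symp)"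
    by (rule inner_commute)
  finally show ?thesis .
qed

lemma matrix_inv_right:
  assumes "invertible M"
  shows "M ** matrix_inv M = mat 1"
  using someI_ex[OF assms[unfolded invertible_def]] by (simp add: matrix_inv_def)

lemma transpose_matrix_inv_antisym:
  assumes "transpose \<Theta> = - \<Theta>" "invertible \<Theta>"
  shows "transpose (matrix_inv \<Theta>) = - matrix_inv (\<Theta> :: real^'n^'n)"
proof -
  have "transpose (\<Theta> ** matrix_inv \<Theta>) = mat 1"
    by (simp add: matrix_inv_right assms(2))
  then have "transpose (matrix_inv \<Theta>) ** \<Theta> = - mat 1"
    by (simp add: matrix_transpose_mul assms(1) mm.minus_right minus_equation_iff)
  then have "transpose (matrix_inv \<Theta>) ** \<Theta> ** matrix_inv \<Theta> = - matrix_inv \<Theta>"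
    by (simp add: mm.minus_left)
  then show ?thesis
    by (simp add: matrix_inv_right assms(2) flip: matrix_mul_assoc)
qed

text \<open>Derivatives are unique, and a functional pairing with \<open>g\<close> vanishes at
  \<open>g\<close> only if \<open>g\<close> is zero.\<close>

lemma has_derivative_zero_iff_gradient:
  fixes f :: "'v::real_inner \<Rightarrow> real"
  assumes "(f has_derivative (\<lambda>h. inner h g)) (at x)"
  shows "(f has_derivative (\<lambda>_. 0)) (at x) \<longleftrightarrow> g = 0"
proof
  assume "(f has_derivative (\<lambda>_. 0)) (at x)"
  with assms have "(\<lambda>h. inner h g) = (\<lambda>_. 0)" by (rule has_derivative_unique)
  then show "g = 0" by (metis inner_eq_zero_iff)
qed (use assms in simp)

section \<open>Gradients of the Lagrangian\<close>

text \<open>The adjoint rules once more, oriented to isolate an increment in the first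
  argument.\<close>

lemma inner_matrix_mult_left: "inner (X ** Y) Z = inner X (Z ** transpose Y)" for Z :: "real^'n^'m"
  using inner_mult_left[of Z X Y] by (simp only: inner_commute)

lemma inner_matrix_mult_right: "inner (X ** Y) Z = inner Y (transpose X ** Z)" for Z :: "real^'n^'m"
  using inner_mult_right[of Z X Y] by (simp only: inner_commute)

lemmas mm_distribs = mm.add_left mm.add_right mm.diff_left mm.diff_right mm.minus_left mm.minus_right

text \<open>The gain \<open>e\<close> enters the upper and lower block rows with opposite signs,
  whence the differences of blocks.\<close>

lemma lagrangian_has_derivative_e:
  assumes inj: "inj (lyap_op (cl_A A C E c e))"
    and c: "c = ctrl_c d \<Theta> b"
    and \<Lambda>: "transpose \<Lambda> = - \<Lambda>"
    and D: "D ** transpose D = mat 1" "D ** symp ** transpose D = symp"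
    and P: "P = ctrl_gram (cl_A A C E c e) (cl_B B D E d b e)"
    and Q: "Q = obs_gram (cl_A A C E c e) (cl_C F G c)"
    and H: "H = Q ** P"
    and q: "q = blk11 Q + blk22 Q - blk12 Q - blk21 Q"
  shows "((\<lambda>y. lagrangian A B C D E F G d \<Theta> b y \<Lambda>) has_derivative
    (\<lambda>h. inner h ((blk21 Q - blk11 Q) ** B ** transpose D + \<Lambda> ** B ** symp ** transpose D
        + (blk21 H - blk11 H) ** transpose C + op_E q \<Lambda> e))) (at e)"
proof -
  note left = bounded_linear.has_derivative[OF mm.bounded_linear_left has_derivative_ident]
  have dA: "(cl_A A C E c has_derivative (\<lambda>h. vcat (hcat (0 - h ** C) 0) (hcat (h ** C) 0))) (at e)"
    unfolding cl_A_def
    by (intro has_derivative_vcat has_derivative_hcat has_derivative_diff has_derivative_const left)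
  have dB: "(cl_B B D E d b has_derivative (\<lambda>h. vcat (hcat (0 - h ** D) 0) (hcat (h ** D) 0))) (at e)"
    unfolding cl_B_def
    by (intro has_derivative_vcat has_derivative_hcat has_derivative_diff has_derivative_const left)
  have dC: "((\<lambda>y. cl_C F G c) has_derivative (\<lambda>h. 0)) (at e)"
    by (rule has_derivative_const)
  have dV: "(lqg_cost A B C D E F G d \<Theta> b has_derivative
      (\<lambda>h. inner 0 (cl_C F G c ** P)
        + inner (vcat (hcat (0 - h ** D) 0) (hcat (h ** D) 0)) (Q ** cl_B B D E d b e)
        + inner (vcat (hcat (0 - h ** C) 0) (hcat (h ** C) 0)) H)) (at e)"
    using lqg_has_derivative[OF dA dB dC inj P Q]
    unfolding lqg_cost_def Let_def c[symmetric] H .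
  have "((\<lambda>y. B - y ** D) has_derivative (\<lambda>h. 0 - h ** D)) (at e)"
    by (intro has_derivative_diff has_derivative_const left)
  from symp_quadratic_has_derivative[OF this \<Lambda>]
  have "((\<lambda>y. (1/2) * inner \<Lambda> (pr_constraint B D E d b y)) has_derivative
      (\<lambda>h. - inner (0 - h ** D) (\<Lambda> ** (B - e ** D) ** symp) + 0)) (at e)"
    unfolding pr_constraint_def inner_add_right distrib_left
    by (intro has_derivative_add has_derivative_const)
  from has_derivative_add[OF dV this]
  have "((\<lambda>y. lagrangian A B C D E F G d \<Theta> b y \<Lambda>) has_derivative
      (\<lambda>h. inner 0 (cl_C F G c ** P)
        + inner (vcat (hcat (0 - h ** D) 0) (hcat (h ** D) 0)) (Q ** cl_B B D E d b e)
        + inner (vcat (hcat (0 - h ** C) 0) (hcat (h ** C) 0)) H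
        + (- inner (0 - h ** D) (\<Lambda> ** (B - e ** D) ** symp) + 0))) (at e)"
    unfolding lagrangian_def .
  moreover have "inner 0 (cl_C F G c ** P)
        + inner (vcat (hcat (0 - h ** D) 0) (hcat (h ** D) 0)) (Q ** cl_B B D E d b e)
        + inner (vcat (hcat (0 - h ** C) 0) (hcat (h ** C) 0)) H
        + (- inner (0 - h ** D) (\<Lambda> ** (B - e ** D) ** symp) + 0)
      = inner h ((blk21 (Q ** cl_B B D E d b e) - blk11 (Q ** cl_B B D E d b e)) ** transpose D
        + (blk21 H - blk11 H) ** transpose C + \<Lambda> ** (B - e ** D) ** symp ** transpose D)" for h
    by (simp add: inner_blocks inner_matrix_mult_left inner_add_right inner_diff_right mm_distribs)
  \<comment> \<open>In the expanded blocks the terms in \<open>e\<close> combine to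
    \<open>q ** e ** D\<close>; the two identities for \<open>D\<close> then remove \<open>D\<close>
    and yield \<open>op_E\<close>.\<close>
  moreover have "(blk21 (Q ** cl_B B D E d b e) - blk11 (Q ** cl_B B D E d b e)) ** transpose D
        + (blk21 H - blk11 H) ** transpose C + \<Lambda> ** (B - e ** D) ** symp ** transpose D
      = (blk21 Q - blk11 Q) ** B ** transpose D + \<Lambda> ** B ** symp ** transpose D
        + (blk21 H - blk11 H) ** transpose C + op_E q \<Lambda> e"
    using D unfolding blk_mult[of Q "cl_B B D E d b e"]
    unfolding cl_B_def blk_vcat_hcat op_E_def q
    by (simp add: mm_distribs algebra_simps flip: matrix_mul_assoc)
  ultimately show ?thesis by simp
qed

text \<open>The gain \<open>b\<close> acts directly through \<open>cl_B\<close> and the constraint,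
  and indirectly through \<open>c\<close> in \<open>cl_A\<close> and \<open>cl_C\<close>.\<close>

lemma lagrangian_has_derivative_b:
  assumes inj: "inj (lyap_op (cl_A A C E c e))"
    and c: "c = ctrl_c d \<Theta> b"
    and \<Theta>: "transpose (matrix_inv \<Theta>) = - matrix_inv \<Theta>"
    and \<Lambda>: "transpose \<Lambda> = - \<Lambda>"
    and P: "P = ctrl_gram (cl_A A C E c e) (cl_B B D E d b e)"
    and Q: "Q = obs_gram (cl_A A C E c e) (cl_C F G c)"
    and H: "H = Q ** P"
    and q: "q = blk11 Q + blk22 Q - blk12 Q - blk21 Q"
  shows "((\<lambda>y. lagrangian A B C D E F G d \<Theta> y e \<Lambda>) has_derivative
    (\<lambda>h. inner h ((blk21 Q - blk11 Q) ** E ** d + \<Lambda> ** E ** d ** symp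
        + matrix_inv \<Theta>
            ** (transpose (blk22 H) ** E + (blk21 P + blk22 P) ** transpose F ** G) ** d ** symp
        + op_B q \<Theta> (blk22 P) d G \<Lambda> b))) (at b)"
proof -
  let ?c = "ctrl_c d \<Theta>"
  note right = bounded_linear.has_derivative[OF mm.bounded_linear_right
      bounded_linear_imp_has_derivative[OF bounded_linear_ctrl_c]]
  have dA: "((\<lambda>y. cl_A A C E (?c y) e) has_derivative
      (\<lambda>h. vcat (hcat 0 0) (hcat 0 (0 + E ** ?c h)))) (at b)"
    unfolding cl_A_def
    by (intro has_derivative_vcat has_derivative_hcat has_derivative_add has_derivative_const right)
  have dB: "((\<lambda>y. cl_B B D E d y e) has_derivative (\<lambda>h. vcat (hcat 0 (0 - h)) (hcat 0 h))) (at b)"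
    unfolding cl_B_def
    by (intro has_derivative_vcat has_derivative_hcat has_derivative_diff has_derivative_const
        has_derivative_ident)
  have dC: "((\<lambda>y. cl_C F G (?c y)) has_derivative (\<lambda>h. hcat 0 (0 + G ** ?c h))) (at b)"
    unfolding cl_C_def
    by (intro has_derivative_hcat has_derivative_add has_derivative_const right)
  have dV: "((\<lambda>y. lqg_cost A B C D E F G d \<Theta> y e) has_derivative
      (\<lambda>h. inner (hcat 0 (0 + G ** ?c h)) (cl_C F G c ** P)
        + inner (vcat (hcat 0 (0 - h)) (hcat 0 h)) (Q ** cl_B B D E d b e)
        + inner (vcat (hcat 0 0) (hcat 0 (0 + E ** ?c h))) H)) (at b)"
    using lqg_has_derivative[OF dA dB dC inj[unfolded c] P[unfolded c] Q[unfolded c]]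
    unfolding lqg_cost_def Let_def c[symmetric] H .
  have "((\<lambda>y. E ** d - y) has_derivative (\<lambda>h. 0 - h)) (at b)"
    by (intro has_derivative_diff has_derivative_const has_derivative_ident)
  from symp_quadratic_has_derivative[OF this \<Lambda>]
  have "((\<lambda>y. (1/2) * inner \<Lambda> (pr_constraint B D E d y e)) has_derivative
      (\<lambda>h. 0 + - inner (0 - h) (\<Lambda> ** (E ** d - b) ** symp))) (at b)"
    unfolding pr_constraint_def inner_add_right distrib_left
    by (intro has_derivative_add has_derivative_const)
  from has_derivative_add[OF dV this]
  have "((\<lambda>y. lagrangian A B C D E F G d \<Theta> y e \<Lambda>) has_derivative
      (\<lambda>h. inner (hcat 0 (0 + G ** ?c h)) (cl_C F G c ** P)
        + inner (vcat (hcat 0 (0 - h)) (hcat 0 h)) (Q ** cl_B B D E d b e)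
        + inner (vcat (hcat 0 0) (hcat 0 (0 + E ** ?c h))) H
        + (0 + - inner (0 - h) (\<Lambda> ** (E ** d - b) ** symp)))) (at b)"
    unfolding lagrangian_def .
  \<comment> \<open>The gradient of the cost with respect to \<open>c\<close>, to be pulled back to
    \<open>b\<close> by \<open>inner_ctrl_c\<close>.\<close>
  moreover define K where
    "K = transpose E ** blk22 H + transpose G ** (F ** blk12 P + (F + G ** c) ** blk22 P)"
  have "inner (hcat 0 (0 + G ** ?c h)) (cl_C F G c ** P)
        + inner (vcat (hcat 0 (0 - h)) (hcat 0 h)) (Q ** cl_B B D E d b e)
        + inner (vcat (hcat 0 0) (hcat 0 (0 + E ** ?c h))) H
        + (0 + - inner (0 - h) (\<Lambda> ** (E ** d - b) ** symp))
      = inner h (blk22 (Q ** cl_B B D E d b e) - blk12 (Q ** cl_B B D E d b e)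
        + matrix_inv \<Theta> ** transpose K ** d ** symp + \<Lambda> ** (E ** d - b) ** symp)" for h
  proof -
    have "inner (G ** ?c h) (F ** blk12 P + (F + G ** c) ** blk22 P) + inner (E ** ?c h) (blk22 H)
        = inner (?c h) K"
      by (simp add: inner_matrix_mult_right K_def mm.add_right inner_add_right)
    also have "\<dots> = inner h (matrix_inv \<Theta> ** transpose K ** d ** symp)"
      by (rule inner_ctrl_c)
    finally show ?thesis
      by (simp add: inner_blocks cl_C_def inner_hcat_0_left inner_add_right inner_diff_right)
  qed
  moreover have "blk22 (Q ** cl_B B D E d b e) - blk12 (Q ** cl_B B D E d b e)
        + matrix_inv \<Theta> ** transpose K ** d ** symp + \<Lambda> ** (E ** d - b) ** symp
      = (blk21 Q - blk11 Q) ** E ** d + \<Lambda> ** E ** d ** symp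
        + matrix_inv \<Theta>
            ** (transpose (blk22 H) ** E + (blk21 P + blk22 P) ** transpose F ** G) ** d ** symp
        + op_B q \<Theta> (blk22 P) d G \<Lambda> b"
  proof -
    have "transpose P = P"
      unfolding P ctrl_gram_def by (intro lyap_symmetric inj) (simp add: matrix_transpose_mul)
    then have P': "transpose (blk12 P) = blk21 P" "transpose (blk22 P) = blk22 P"
      by (metis blk_transpose transpose_transpose)+
    \<comment> \<open>The signs from transposing \<open>symp\<close> and the inverse of \<Theta>
      cancel.\<close>
    have c': "transpose c = matrix_inv \<Theta> ** b ** symp ** transpose d"
      by (simp add: c ctrl_c_def matrix_transpose_mul \<Theta> transpose_symp mm_distribs matrix_mul_assoc)
    \<comment> \<open>Substituting \<open>c'\<close> exposes the part linear in \<open>b\<close>,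
      the last summand, which becomes the middle term of \<open>op_B\<close>.\<close>
    have K': "transpose K = transpose (blk22 H) ** E + (blk21 P + blk22 P) ** transpose F ** G
        + blk22 P ** matrix_inv \<Theta> ** b ** symp ** transpose d ** transpose G ** G"
      by (simp add: K_def transpose_add matrix_transpose_mul P' c' mm_distribs matrix_mul_assoc)
    show ?thesis
      unfolding blk_mult[of Q "cl_B B D E d b e"] K'
      unfolding cl_B_def blk_vcat_hcat op_B_def q
      by (simp add: mm_distribs algebra_simps flip: matrix_mul_assoc)
  qed
  ultimately show ?thesis by simp
qed

theorem theorem3:
  fixes A :: "real^'n^'n"
    and B :: "real^('m1::finite \<times> 2)^'n"
    and C :: "real^'n^('p1::finite \<times> 2)"
    and D :: "real^('m1 \<times> 2)^('p1 \<times> 2)"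
    and E :: "real^('p2::finite \<times> 2)^'n"
    and d :: "real^('m2::finite \<times> 2)^('p2 \<times> 2)"
    and F :: "real^'n^'r"
    and G :: "real^('p2 \<times> 2)^'r"
    and \<Theta>\<^sub>1 \<Lambda> :: "real^'n^'n"
    and b :: "real^('m2 \<times> 2)^'n"
    and e :: "real^('p1 \<times> 2)^'n"
    and c :: "real^'n^('p2 \<times> 2)"
    and P Q H :: "real^('n + 'n)^('n + 'n)"
    and q :: "real^'n^'n"
  assumes "even CARD('n)"
    and "CARD('p1 \<times> 2) \<le> CARD('m1 \<times> 2)" and "CARD('p2 \<times> 2) \<le> CARD('m2 \<times> 2)"
    and "feedthrough D" and "feedthrough d"
    and "\<Theta>\<^sub>1 \<in> antisym_mats" and "invertible \<Theta>\<^sub>1"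
    and "A ** \<Theta>\<^sub>1 + \<Theta>\<^sub>1 ** transpose A + B ** symp ** transpose B + E ** symp ** transpose E = 0"
    and "C ** \<Theta>\<^sub>1 + D ** symp ** transpose B = 0"
    and "rank G = CARD('p2 \<times> 2)"
    and "c = ctrl_c d \<Theta>\<^sub>1 b"
    and "pr_constraint B D E d b e = 0"
    and "hurwitz (A - e ** C)" and "hurwitz (A + E ** c)"
    and "\<Lambda> \<in> antisym_mats"
    and "P = ctrl_gram (cl_A A C E c e) (cl_B B D E d b e)"
    and "Q = obs_gram (cl_A A C E c e) (cl_C F G c)"
    and "H = Q ** P"
    and "q = blk11 Q + blk22 Q - blk12 Q - blk21 Q"
  shows "stationary_point A B C D E F G d \<Theta>\<^sub>1 b e \<Lambda> \<longleftrightarrow>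
      (blk21 Q - blk11 Q) ** E ** d + \<Lambda> ** E ** d ** symp
        + matrix_inv \<Theta>\<^sub>1
            ** (transpose (blk22 H) ** E + (blk21 P + blk22 P) ** transpose F ** G) ** d ** symp
        + op_B q \<Theta>\<^sub>1 (blk22 P) d G \<Lambda> b = 0
      \<and> (blk21 Q - blk11 Q) ** B ** transpose D + \<Lambda> ** B ** symp ** transpose D
        + (blk21 H - blk11 H) ** transpose C
        + op_E q \<Lambda> e = 0"
proof -
  have D: "D ** transpose D = mat 1" "D ** symp ** transpose D = symp"
    using \<open>feedthrough D\<close> by (auto simp: feedthrough_def)
  have \<Lambda>: "transpose \<Lambda> = - \<Lambda>" and \<Theta>: "transpose (matrix_inv \<Theta>\<^sub>1) = - matrix_inv \<Theta>\<^sub>1"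
    using assms by (auto simp: antisym_mats_def transpose_matrix_inv_antisym)
  have A: "hurwitz (cl_A A C E c e)"
    unfolding cl_A_def by (intro hurwitz_block_triangular assms)
  have inj: "inj (lyap_op (cl_A A C E c e))"
    unfolding linear_injective_0[OF linear_lyap_op] lyap_op_def
    using hurwitz_lyap_injective[OF A] by blast
  \<comment> \<open>The multiplier is paired with the constraint value, which is zero at this
    controller.\<close>
  have "((\<lambda>l. lagrangian A B C D E F G d \<Theta>\<^sub>1 b e l) has_derivative (\<lambda>_. 0)) (at \<Lambda> within antisym_mats)"
    by (simp add: lagrangian_def assms(12))
  then have "stationary_point A B C D E F G d \<Theta>\<^sub>1 b e \<Lambda> \<longleftrightarrow>
     ((\<lambda>x. lagrangian A B C D E F G d \<Theta>\<^sub>1 x e \<Lambda>) has_derivative (\<lambda>_. 0)) (at b) \<and>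
     ((\<lambda>y. lagrangian A B C D E F G d \<Theta>\<^sub>1 b y \<Lambda>) has_derivative (\<lambda>_. 0)) (at e)"
    using A assms(15) by (simp add: stationary_point_def flip: assms(11))
  then show ?thesis
    unfolding has_derivative_zero_iff_gradient[OF lagrangian_has_derivative_b[OF inj assms(11) \<Theta> \<Lambda> assms(16-19)]]
      has_derivative_zero_iff_gradient[OF lagrangian_has_derivative_e[OF inj assms(11) \<Lambda> D assms(16-19)]] .
qed

end
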